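(* Let $X$ be a compact metric space, $G_1=\{\mathrm{id}_X,f_1,\dots,f_m\}$ a finite set of continuous self-maps of $X$, $\Phi=(\phi_1,\dots,\phi_m)\in\mathcal C(X,\mathbb R^m)$ a continuous multi-potential, $Y\subset X$ and $\omega\in\Sigma_m^+$. Then $$P^+_l(\Phi,Y,G_1)\le P^A(\Phi,Y,G_1)\le P(\Phi,Y,G_1,\omega).$$ In particular, for any $1\le j\le m$, $$P^+_l(\Phi,Y,G_1)\le P^A(\Phi,Y,G_1)\le P(\phi_j,Y,f_j).$$
   Context: Let $(X,d)$ be a compact metric space, $f_1,\dots,f_m:X\to X$ continuous, $f_{j_1\dots j_n}:=f_{j_1}\circ\dots\circ f_{j_n}$. Let $\Sigma_m^*$ be the set of finite words $C=(i_1,\dots,i_n)$, $n\ge1$, over $\{1,\dots,m\}$, $n(C)=n$ the length, and $\Sigma_m^+$ the space of sequences $\omega=(\omega_0,\omega_1,\dots)$ over $\{1,\dots,m\}$. For $C=(i_1,\dots,i_n)$, $$B_n(y,C,\varepsilon)=\{z\in X: d(y,z)<\varepsilon,\ d(f_{i_k\dots i_1}(y),f_{i_k\dots i_1}(z))<\varepsilon,\ 1\le k\le n\},$$ $S_n\Phi(y,C)=\phi_{i_1}(y)+\phi_{i_2}(f_{i_1}(y))+\dots+\phi_{i_n}(f_{i_{n-1}\dots i_1}(y))$; for $\omega\in\Sigma_m^+$ set $B_n(y,\omega,\varepsilon)=B_n(y,(\omega_0,\dots,\omega_{n-1}),\varepsilon)$ and $S_n\Phi(y,\omega)=S_n\Phi(y,(\omega_0,\dots,\omega_{n-1}))$.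 Amalgamated pressure $P^A(\Phi,Y,G_1)$: $$M(\lambda,\Phi,Y,N,\varepsilon)=\inf_\Gamma\sum_{(C,y)\in\Gamma}\exp(-\lambda n(C)+S_{n(C)}\Phi(y,C)),$$ the infimum over at most countable $\Gamma\subset\Sigma_m^*\times X$ with $Y\subset\bigcup_{(C,y)\in\Gamma}B_{n(C)}(y,C,\varepsilon)$ and $n(C)\ge N$ for all $(C,y)\in\Gamma$; $m(\lambda,\Phi,Y,\varepsilon)=\lim_{N\to\infty}M(\lambda,\Phi,Y,N,\varepsilon)$; $P^A(\Phi,Y,G_1,\varepsilon)=\inf\{\lambda:m(\lambda,\Phi,Y,\varepsilon)=0\}$; $P^A(\Phi,Y,G_1)=\lim_{\varepsilon\to0}P^A(\Phi,Y,G_1,\varepsilon)$. Trajectory pressure $P(\Phi,Y,G_1,\omega)$ along a fixed $\omega\in\Sigma_m^+$: defined by the same procedure from $$M_\omega(\lambda,\Phi,Y,N,\varepsilon)=\inf\sum_{y\in\Gamma}\exp(-\lambda n+S_n\Phi(y,\omega)),$$ the infimum over at most countable $\Gamma\subset Y$ with integers $n=n(y)\ge N$ such that $Y\subset\bigcup_{y\in\Gamma}B_n(y,\omega,\varepsilon)$. Lower exhaustive pressure $P^+_l(\Phi,Y,G_1)$: let $B_n^+(x,G_1,\varepsilon)=\bigcup_{|C|=n}B_n(x,C,\varepsilon)$ (union over all words $C$ of length $n$), $s_n\Phi(x)=\inf_{\omega\in\Sigma_m^+}S_n\Phi(x,\omega)$, and $$M_l^+(\Phi,Y,\lambda,N,\varepsilon)=\inf\sum_{x\in\mathcal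 F}\exp(s_n\Phi(x)-\lambda n),$$ the infimum over at most countable families of centers $x\in\mathcal F\subset X$ with integers $n=n(x)\ge N$ such that $Y\subset\bigcup_{x\in\mathcal F}B_n^+(x,G_1,\varepsilon)$; $m_l^+(\Phi,Y,\lambda,\varepsilon)=\lim_{N\to\infty}M_l^+$; $P_l^+(\Phi,Y,G_1,\varepsilon)=\inf\{\lambda:m_l^+(\Phi,Y,\lambda,\varepsilon)=0\}$; $P_l^+(\Phi,Y,G_1)=\lim_{\varepsilon\to0}P_l^+(\Phi,Y,G_1,\varepsilon)$. $P(\phi_j,Y,f_j)$ is the usual (Bowen/Pesin–Pitskel, Carathéodory-type) topological pressure of the single potential $\phi_j$ for the single map $f_j$ on the (not necessarily compact or invariant) set $Y$; it is the trajectory pressure along $\omega=(j,j,j,\dots)$. All pressures take values in the extended reals. *)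

theory Defs
  imports "HOL-Analysis.Analysis"
begin

text \<open>The space is a compact set \<open>X\<close>; the generators \<open>f j\<close> and the potentials \<open>\<phi> j\<close> are
  indexed by \<open>j \<in> {1..m}\<close> and only matter on \<open>X\<close>.\<close>

definition words :: "nat \<Rightarrow> nat list set" where
  "words m = {C \<in> lists {1..m}. C \<noteq> []}"

definition seqs :: "nat \<Rightarrow> (nat \<Rightarrow> nat) set" where
  "seqs m = {\<omega>. \<forall>i. \<omega> i \<in> {1..m}}"

definition prefix_word :: "(nat \<Rightarrow> nat) \<Rightarrow> nat \<Rightarrow> nat list" where
  "prefix_word \<omega> n = map \<omega> [0..<n]"

text \<open>\<open>word_map f [j\<^sub>1, \<dots>, j\<^sub>n] = f j\<^sub>1 \<circ> \<dots> \<circ> f j\<^sub>n\<close>. Along a word \<open>C = [i\<^sub>1, \<dots>, i\<^sub>n]\<close> the generators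
  are applied from the left, so \<open>f\<^sub>i\<^sub>k \<circ> \<dots> \<circ> f\<^sub>i\<^sub>1\<close> is \<open>word_map f (rev (take k C))\<close>.\<close>

definition word_map :: "(nat \<Rightarrow> 'a \<Rightarrow> 'a) \<Rightarrow> nat list \<Rightarrow> 'a \<Rightarrow> 'a" where
  "word_map f js = foldr (\<lambda>j g. f j \<circ> g) js id"

definition word_ball ::
  "'a::metric_space set \<Rightarrow> (nat \<Rightarrow> 'a \<Rightarrow> 'a) \<Rightarrow> 'a \<Rightarrow> nat list \<Rightarrow> real \<Rightarrow> 'a set" where
  "word_ball X f y C \<epsilon> = {z \<in> X. dist y z < \<epsilon> \<and>
     (\<forall>k\<in>{1..length C}. dist (word_map f (rev (take k C)) y) (word_map f (rev (take k C)) z) < \<epsilon>)}"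

definition word_sum ::
  "(nat \<Rightarrow> 'a \<Rightarrow> 'a) \<Rightarrow> (nat \<Rightarrow> 'a \<Rightarrow> real) \<Rightarrow> 'a \<Rightarrow> nat list \<Rightarrow> real" where
  "word_sum f \<phi> y C = (\<Sum>k<length C. \<phi> (C ! k) (word_map f (rev (take k C)) y))"

text \<open>The passage from a covering sum \<open>M \<lambda> N \<epsilon>\<close> to a pressure, common to all the pressures.
  For every covering sum below, \<open>M \<lambda> N \<epsilon>\<close> is increasing in \<open>N\<close> and decreasing in \<open>\<epsilon>\<close>, so both
  limits exist. The exponent \<open>\<lambda>\<close> is real and the infimum is taken in the extended reals, so it is
  \<open>\<infinity>\<close> over the empty set and \<open>- \<infinity>\<close> over all of \<open>\<real>\<close>.\<close>

definition critical_exponent :: "(real \<Rightarrow> nat \<Rightarrow> ennreal) \<Rightarrow> ereal" where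
  "critical_exponent M = Inf (ereal ` {l. lim (\<lambda>N. M l N) = 0})"

definition caratheodory_pressure :: "(real \<Rightarrow> nat \<Rightarrow> real \<Rightarrow> ennreal) \<Rightarrow> ereal" where
  "caratheodory_pressure M = Lim (at_right 0) (\<lambda>\<epsilon>. critical_exponent (\<lambda>l N. M l N \<epsilon>))"

definition amalgamated_M ::
  "nat \<Rightarrow> 'a::metric_space set \<Rightarrow> (nat \<Rightarrow> 'a \<Rightarrow> 'a) \<Rightarrow> (nat \<Rightarrow> 'a \<Rightarrow> real) \<Rightarrow> 'a set
    \<Rightarrow> real \<Rightarrow> nat \<Rightarrow> real \<Rightarrow> ennreal" where
  "amalgamated_M m X f \<phi> Y l N \<epsilon> =
    (INF \<Gamma> \<in> {\<Gamma>. countable \<Gamma> \<and> \<Gamma> \<subseteq> words m \<times> X \<and> Y \<subseteq> (\<Union>(C, y)\<in>\<Gamma>. word_ball X f y C \<epsilon>) \<and>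
                  (\<forall>(C, y)\<in>\<Gamma>. N \<le> length C)}.
       \<Sum>\<^sub>\<infinity>(C, y)\<in>\<Gamma>. ennreal (exp (- l * real (length C) + word_sum f \<phi> y C)))"

definition amalgamated_pressure ::
  "nat \<Rightarrow> 'a::metric_space set \<Rightarrow> (nat \<Rightarrow> 'a \<Rightarrow> 'a) \<Rightarrow> (nat \<Rightarrow> 'a \<Rightarrow> real) \<Rightarrow> 'a set \<Rightarrow> ereal" where
  "amalgamated_pressure m X f \<phi> Y = caratheodory_pressure (amalgamated_M m X f \<phi> Y)"

definition trajectory_M ::
  "'a::metric_space set \<Rightarrow> (nat \<Rightarrow> 'a \<Rightarrow> 'a) \<Rightarrow> (nat \<Rightarrow> 'a \<Rightarrow> real) \<Rightarrow> 'a set \<Rightarrow> (nat \<Rightarrow> nat)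
    \<Rightarrow> real \<Rightarrow> nat \<Rightarrow> real \<Rightarrow> ennreal" where
  "trajectory_M X f \<phi> Y \<omega> l N \<epsilon> =
    (INF (\<Gamma>, n) \<in> {(\<Gamma>, n). countable \<Gamma> \<and> \<Gamma> \<subseteq> Y \<and> (\<forall>y\<in>\<Gamma>. N \<le> n y) \<and>
                       Y \<subseteq> (\<Union>y\<in>\<Gamma>. word_ball X f y (prefix_word \<omega> (n y)) \<epsilon>)}.
       \<Sum>\<^sub>\<infinity>y\<in>\<Gamma>. ennreal (exp (- l * real (n y) + word_sum f \<phi> y (prefix_word \<omega> (n y)))))"

definition trajectory_pressure ::
  "'a::metric_space set \<Rightarrow> (nat \<Rightarrow> 'a \<Rightarrow> 'a) \<Rightarrow> (nat \<Rightarrow> 'a \<Rightarrow> real) \<Rightarrow> 'a set \<Rightarrow> (nat \<Rightarrow> nat)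
    \<Rightarrow> ereal" where
  "trajectory_pressure X f \<phi> Y \<omega> = caratheodory_pressure (trajectory_M X f \<phi> Y \<omega>)"

definition exhaustive_ball ::
  "nat \<Rightarrow> 'a::metric_space set \<Rightarrow> (nat \<Rightarrow> 'a \<Rightarrow> 'a) \<Rightarrow> nat \<Rightarrow> 'a \<Rightarrow> real \<Rightarrow> 'a set" where
  "exhaustive_ball m X f n x \<epsilon> = (\<Union>C\<in>{C \<in> lists {1..m}. length C = n}. word_ball X f x C \<epsilon>)"

text \<open>The infimum is over a finite set of values, since a word sum depends only on the first \<open>n\<close>
  letters.\<close>

definition lower_sum ::
  "nat \<Rightarrow> (nat \<Rightarrow> 'a \<Rightarrow> 'a) \<Rightarrow> (nat \<Rightarrow> 'a \<Rightarrow> real) \<Rightarrow> nat \<Rightarrow> 'a \<Rightarrow> real" where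
  "lower_sum m f \<phi> n x = (INF \<omega>\<in>seqs m. word_sum f \<phi> x (prefix_word \<omega> n))"

definition lower_exhaustive_M ::
  "nat \<Rightarrow> 'a::metric_space set \<Rightarrow> (nat \<Rightarrow> 'a \<Rightarrow> 'a) \<Rightarrow> (nat \<Rightarrow> 'a \<Rightarrow> real) \<Rightarrow> 'a set
    \<Rightarrow> real \<Rightarrow> nat \<Rightarrow> real \<Rightarrow> ennreal" where
  "lower_exhaustive_M m X f \<phi> Y l N \<epsilon> =
    (INF (F, n) \<in> {(F, n). countable F \<and> F \<subseteq> X \<and> (\<forall>x\<in>F. N \<le> n x) \<and>
                       Y \<subseteq> (\<Union>x\<in>F. exhaustive_ball m X f (n x) x \<epsilon>)}.
       \<Sum>\<^sub>\<infinity>x\<in>F. ennreal (exp (lower_sum m f \<phi> (n x) x - l * real (n x))))"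

definition lower_exhaustive_pressure ::
  "nat \<Rightarrow> 'a::metric_space set \<Rightarrow> (nat \<Rightarrow> 'a \<Rightarrow> 'a) \<Rightarrow> (nat \<Rightarrow> 'a \<Rightarrow> real) \<Rightarrow> 'a set \<Rightarrow> ereal" where
  "lower_exhaustive_pressure m X f \<phi> Y = caratheodory_pressure (lower_exhaustive_M m X f \<phi> Y)"

text \<open>Topological pressure of one potential \<open>\<psi>\<close> for one map \<open>g\<close> on an arbitrary subset \<open>Y\<close>. The
  Bowen balls control the iterates \<open>0, \<dots>, n\<close>, in agreement with the balls along words.\<close>

definition bowen_ball :: "'a::metric_space set \<Rightarrow> ('a \<Rightarrow> 'a) \<Rightarrow> nat \<Rightarrow> 'a \<Rightarrow> real \<Rightarrow> 'a set" where
  "bowen_ball X g n y \<epsilon> = {z \<in> X. \<forall>k\<le>n. dist ((g ^^ k) y) ((g ^^ k) z) < \<epsilon>}"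

definition topological_M ::
  "'a::metric_space set \<Rightarrow> ('a \<Rightarrow> 'a) \<Rightarrow> ('a \<Rightarrow> real) \<Rightarrow> 'a set \<Rightarrow> real \<Rightarrow> nat \<Rightarrow> real \<Rightarrow> ennreal" where
  "topological_M X g \<psi> Y l N \<epsilon> =
    (INF (\<Gamma>, n) \<in> {(\<Gamma>, n). countable \<Gamma> \<and> \<Gamma> \<subseteq> Y \<and> (\<forall>y\<in>\<Gamma>. N \<le> n y) \<and>
                       Y \<subseteq> (\<Union>y\<in>\<Gamma>. bowen_ball X g (n y) y \<epsilon>)}.
       \<Sum>\<^sub>\<infinity>y\<in>\<Gamma>. ennreal (exp (- l * real (n y) + (\<Sum>k<n y. \<psi> ((g ^^ k) y)))))"

definition topological_pressure ::
  "'a::metric_space set \<Rightarrow> ('a \<Rightarrow> 'a) \<Rightarrow> ('a \<Rightarrow> real) \<Rightarrow> 'a set \<Rightarrow> ereal" where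
  "topological_pressure X g \<psi> Y = caratheodory_pressure (topological_M X g \<psi> Y)"

lemma word_map_replicate: "word_map f (replicate k j) = f j ^^ k"
  by (induction k) (auto simp: word_map_def)

lemma prefix_word_const: "prefix_word (\<lambda>_. j) n = replicate n j"
  by (simp add: prefix_word_def map_replicate_const)

lemma word_ball_replicate: "word_ball X f y (replicate n j) \<epsilon> = bowen_ball X (f j) n y \<epsilon>"
proof -
  have split: "(\<forall>k\<le>n. P k) \<longleftrightarrow> P 0 \<and> (\<forall>k\<in>{1..n}. P k)" for P
    by (metis One_nat_def Suc_leI atLeastAtMost_iff le0 neq0_conv)
  show ?thesis
    unfolding word_ball_def bowen_ball_def split
    by (auto simp: word_map_replicate min_absorb2 min_absorb1)
qed

lemma word_sum_replicate: "word_sum f \<phi> y (replicate n j) = (\<Sum>k<n. \<phi> j ((f j ^^ k) y))"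
  by (auto simp: word_sum_def word_map_replicate min_absorb2 min_absorb1 intro!: sum.cong)

lemma trajectory_pressure_const:
  "trajectory_pressure X f \<phi> Y (\<lambda>_. j) = topological_pressure X (f j) (\<phi> j) Y"
proof -
  have "trajectory_M X f \<phi> Y (\<lambda>_. j) = topological_M X (f j) (\<phi> j) Y"
    by (intro ext)
      (simp add: trajectory_M_def topological_M_def prefix_word_const word_ball_replicate
        word_sum_replicate)
  then show ?thesis
    by (simp add: trajectory_pressure_def topological_pressure_def)
qed

end

theory Submission
  imports Defs
begin

text \<open>Both inequalities compare covers. A cover of \<open>Y\<close> along \<open>\<omega>\<close> is in particular a cover by balls
  along words. Conversely a cover by balls along words is a cover by exhaustive balls, except that
  the same centre may occur with several lengths, whereas the length is a function of the centre in
  an exhaustive cover. To separate the centres, assign to each point of \<open>Y\<close> one ball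
  containing it and recentre every assigned ball at a point to which it was assigned. This doubles
  the radius and, by uniform continuity of the potentials, raises \<open>\<lambda>\<close> by an arbitrarily small
  amount, so it does not affect the limit \<open>\<epsilon> \<rightarrow> 0\<close>.\<close>

section \<open>Critical exponents and pressures of covering sums\<close>

lemma tendsto_at_right_SUP:
  fixes h :: "'a::{linorder_topology, no_top} \<Rightarrow> 'b::{complete_linorder, linorder_topology}"
  assumes "\<And>x y. a < x \<Longrightarrow> x \<le> y \<Longrightarrow> h y \<le> h x"
  shows "(h \<longlongrightarrow> (SUP x\<in>{a<..}. h x)) (at_right a)"
proof (rule increasing_tendsto)
  show "\<forall>\<^sub>F x in at_right a. h x \<le> (SUP x\<in>{a<..}. h x)"
    using eventually_at_right_less by eventually_elim (simp add: SUP_upper)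
next
  fix c assume "c < (SUP x\<in>{a<..}. h x)"
  then obtain e where "a < e" "c < h e"
    by (auto simp: less_SUP_iff)
  then show "\<forall>\<^sub>F x in at_right a. c < h x"
    using assms by (intro eventually_at_rightI[of a e]) (auto intro: less_le_trans)
qed

lemma lim_eq_SUP:
  fixes X :: "nat \<Rightarrow> 'a::{complete_linorder, linorder_topology}"
  assumes "mono X"
  shows "lim X = (SUP n. X n)"
  using assms by (intro limI LIMSEQ_SUP)

lemma critical_exponent_le_shift:
  assumes "\<And>l. mono (M l)" "\<And>l. mono (M' l)"
    and dominated: "\<And>l N. \<exists>N'. M' (l + d) N \<le> M l N'"
  shows "critical_exponent M' \<le> critical_exponent M + ereal d"
proof -
  have "critical_exponent M' - ereal d \<le> critical_exponent M"
    unfolding critical_exponent_def[of M]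
  proof (rule Inf_greatest, clarify)
    fix l assume "lim (\<lambda>N. M l N) = 0"
    moreover have "(SUP N. M' (l + d) N) \<le> (SUP N. M l N)"
      using dominated by (intro SUP_mono) auto
    ultimately have "lim (\<lambda>N. M' (l + d) N) = 0"
      using assms by (simp add: lim_eq_SUP)
    then have "critical_exponent M' \<le> ereal (l + d)"
      unfolding critical_exponent_def by (intro INF_lower) simp
    then show "critical_exponent M' - ereal d \<le> ereal l"
      by (simp add: ereal_minus_le)
  qed
  then show ?thesis
    by (simp add: ereal_minus_le)
qed

definition covering_sum :: "(real \<Rightarrow> nat \<Rightarrow> real \<Rightarrow> ennreal) \<Rightarrow> bool" where
  "covering_sum M \<longleftrightarrow> (\<forall>l \<epsilon>. mono (\<lambda>N. M l N \<epsilon>)) \<and> (\<forall>l N. antimono (M l N))"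

lemma covering_sum_INF:
  assumes "\<And>N N' \<epsilon> \<epsilon>'. N \<le> N' \<Longrightarrow> \<epsilon> \<le> \<epsilon>' \<Longrightarrow> \<C> N' \<epsilon> \<subseteq> \<C> N \<epsilon>'"
  shows "covering_sum (\<lambda>l N \<epsilon>. INF \<Gamma>\<in>\<C> N \<epsilon>. S l \<Gamma>)"
  unfolding covering_sum_def
  by (intro conjI allI monoI antimonoI INF_superset_mono assms order_refl)

lemma covering_sum_antimonoD:
  "covering_sum M \<Longrightarrow> \<epsilon> \<le> \<epsilon>' \<Longrightarrow> M l N \<epsilon>' \<le> M l N \<epsilon>"
  by (simp add: covering_sum_def antimonoD)

lemma covering_sum_monoD:
  "covering_sum M \<Longrightarrow> N \<le> N' \<Longrightarrow> M l N \<epsilon> \<le> M l N' \<epsilon>"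
  by (auto simp: covering_sum_def mono_def)

lemma covering_sum_critical_exponent_le:
  assumes "covering_sum M" "covering_sum M'"
    and "\<And>l N. \<exists>N'. M' (l + d) N \<epsilon>' \<le> M l N' \<epsilon>"
  shows "critical_exponent (\<lambda>l N. M' l N \<epsilon>') \<le> critical_exponent (\<lambda>l N. M l N \<epsilon>) + ereal d"
  using assms by (intro critical_exponent_le_shift) (auto simp: covering_sum_def)

lemma caratheodory_pressure_eq_SUP:
  assumes "covering_sum M"
  shows "caratheodory_pressure M = (SUP \<epsilon>\<in>{0<..}. critical_exponent (\<lambda>l N. M l N \<epsilon>))"
  unfolding caratheodory_pressure_def
proof (intro tendsto_Lim tendsto_at_right_SUP)
  fix \<epsilon> \<epsilon>' :: real assume "\<epsilon> \<le> \<epsilon>'"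
  with assms have "M (l + 0) N \<epsilon>' \<le> M l N \<epsilon>" for l N
    by (simp add: covering_sum_antimonoD)
  then show "critical_exponent (\<lambda>l N. M l N \<epsilon>') \<le> critical_exponent (\<lambda>l N. M l N \<epsilon>)"
    using covering_sum_critical_exponent_le[OF assms assms, of 0 \<epsilon>' \<epsilon>] by fastforce
qed simp

lemma caratheodory_pressure_mono:
  assumes covering: "covering_sum M" and covering': "covering_sum M'"
    and dominated: "\<And>l N \<epsilon>. \<exists>N'. M' l N \<epsilon> \<le> M l N' \<epsilon>"
  shows "caratheodory_pressure M' \<le> caratheodory_pressure M"
  unfolding caratheodory_pressure_eq_SUP[OF covering] caratheodory_pressure_eq_SUP[OF covering']
proof (rule SUP_mono')
  fix \<epsilon> :: real
  have "critical_exponent (\<lambda>l N. M' l N \<epsilon>) \<le> critical_exponent (\<lambda>l N. M l N \<epsilon>) + ereal 0"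
    by (rule covering_sum_critical_exponent_le[OF covering covering']) (simp add: dominated)
  then show "critical_exponent (\<lambda>l N. M' l N \<epsilon>) \<le> critical_exponent (\<lambda>l N. M l N \<epsilon>)"
    by simp
qed

lemma caratheodory_pressure_le_shift:
  assumes covering: "covering_sum M" and covering': "covering_sum M'"
    and dominated: "\<And>\<delta> \<epsilon>'. \<delta> > 0 \<Longrightarrow> \<epsilon>' > 0 \<Longrightarrow> \<exists>\<epsilon>>0. \<forall>l N. M' (l + \<delta>) N \<epsilon>' \<le> M l N \<epsilon>"
  shows "caratheodory_pressure M' \<le> caratheodory_pressure M"
  unfolding caratheodory_pressure_eq_SUP[OF covering']
proof (rule SUP_least, rule ereal_le_epsilon2)
  fix \<epsilon>' \<delta> :: real assume "\<epsilon>' \<in> {0<..}" "0 < \<delta>"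
  then obtain \<epsilon> where "\<epsilon> > 0" and shift: "M' (l + \<delta>) N \<epsilon>' \<le> M l N \<epsilon>" for l N
    using dominated[of \<delta> \<epsilon>'] by auto
  have "critical_exponent (\<lambda>l N. M' l N \<epsilon>') \<le> critical_exponent (\<lambda>l N. M l N \<epsilon>) + ereal \<delta>"
    by (rule covering_sum_critical_exponent_le[OF covering covering']) (rule exI, rule shift)
  also have "\<dots> \<le> caratheodory_pressure M + ereal \<delta>"
    unfolding caratheodory_pressure_eq_SUP[OF covering]
    using \<open>\<epsilon> > 0\<close> by (intro add_right_mono SUP_upper) simp
  finally show "critical_exponent (\<lambda>l N. M' l N \<epsilon>') \<le> caratheodory_pressure M + ereal \<delta>" .
qed

section \<open>Balls and sums along words\<close>

abbreviation word_orbit :: "(nat \<Rightarrow> 'a \<Rightarrow> 'a) \<Rightarrow> nat list \<Rightarrow> 'a \<Rightarrow> nat \<Rightarrow> 'a" where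
  "word_orbit f C y k \<equiv> word_map f (rev (take k C)) y"

lemma mem_word_ball_iff:
  "z \<in> word_ball X f y C \<epsilon> \<longleftrightarrow>
    z \<in> X \<and> (\<forall>k\<le>length C. dist (word_orbit f C y k) (word_orbit f C z k) < \<epsilon>)"
proof -
  have "(\<forall>k\<le>n. P k) \<longleftrightarrow> P 0 \<and> (\<forall>k\<in>{1..n}. P k)" for P and n :: nat
    by (metis One_nat_def Suc_leI atLeastAtMost_iff le0 neq0_conv)
  then show ?thesis
    by (simp add: word_ball_def word_map_def)
qed

lemma word_ball_mono: "\<epsilon> \<le> \<epsilon>' \<Longrightarrow> word_ball X f y C \<epsilon> \<subseteq> word_ball X f y C \<epsilon>'"
  by (force simp: mem_word_ball_iff)

lemma word_ball_triangle:
  assumes "x \<in> word_ball X f y C \<delta>"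
  shows "word_ball X f y C \<epsilon> \<subseteq> word_ball X f x C (\<delta> + \<epsilon>)"
proof
  fix z assume "z \<in> word_ball X f y C \<epsilon>"
  with assms show "z \<in> word_ball X f x C (\<delta> + \<epsilon>)"
    unfolding mem_word_ball_iff by (metis dist_commute dist_triangle_less_add)
qed

lemma exhaustive_ball_mono:
  "\<epsilon> \<le> \<epsilon>' \<Longrightarrow> exhaustive_ball m X f n x \<epsilon> \<subseteq> exhaustive_ball m X f n x \<epsilon>'"
  unfolding exhaustive_ball_def by (intro UN_mono word_ball_mono order_refl)

lemma word_ball_subset_exhaustive_ball:
  "C \<in> words m \<Longrightarrow> word_ball X f x C \<epsilon> \<subseteq> exhaustive_ball m X f (length C) x \<epsilon>"
  by (auto simp: exhaustive_ball_def words_def)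

lemma word_map_in:
  assumes "\<And>j. j \<in> J \<Longrightarrow> f j \<in> X \<rightarrow> X" "set C \<subseteq> J" "x \<in> X"
  shows "word_map f C x \<in> X"
  using assms(2) by (induction C) (use assms in \<open>auto simp: word_map_def\<close>)

definition modulus_on ::
  "'i set \<Rightarrow> 'a::metric_space set \<Rightarrow> ('i \<Rightarrow> 'a \<Rightarrow> 'b::metric_space) \<Rightarrow> real \<Rightarrow> real \<Rightarrow> bool" where
  "modulus_on J X \<phi> \<epsilon> \<delta> \<longleftrightarrow>
    (\<forall>j\<in>J. \<forall>u\<in>X. \<forall>v\<in>X. dist u v < \<epsilon> \<longrightarrow> dist (\<phi> j u) (\<phi> j v) \<le> \<delta>)"

lemma modulus_on_antimono: "modulus_on J X \<phi> \<epsilon>' \<delta> \<Longrightarrow> \<epsilon> \<le> \<epsilon>' \<Longrightarrow> modulus_on J X \<phi> \<epsilon> \<delta>"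
  by (auto simp: modulus_on_def)

lemma compact_finite_family_modulus_on:
  assumes "compact X" "finite J" "\<And>j. j \<in> J \<Longrightarrow> continuous_on X (\<phi> j)" "\<delta> > 0"
  obtains \<epsilon> where "\<epsilon> > 0" "modulus_on J X \<phi> \<epsilon> \<delta>"
proof -
  have "\<forall>\<^sub>F (u, v) in uniformity. u \<in> X \<longrightarrow> v \<in> X \<longrightarrow> dist (\<phi> j u) (\<phi> j v) < \<delta>" if "j \<in> J" for j
  proof -
    have "uniformly_continuous_on X (\<phi> j)"
      using assms that by (intro compact_uniformly_continuous) auto
    moreover have "\<forall>\<^sub>F (a, b) in uniformity. dist a b < \<delta>"
      using \<open>\<delta> > 0\<close> by (auto simp: eventually_uniformity_metric)
    ultimately show ?thesis
      by (auto dest: uniformly_continuous_onD)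
  qed
  then have "\<forall>\<^sub>F p in uniformity. \<forall>j\<in>J. case p of (u, v) \<Rightarrow>
      u \<in> X \<longrightarrow> v \<in> X \<longrightarrow> dist (\<phi> j u) (\<phi> j v) < \<delta>"
    using \<open>finite J\<close> by (intro eventually_ball_finite) auto
  then obtain \<epsilon> where "\<epsilon> > 0" and close: "dist u v < \<epsilon> \<Longrightarrow> j \<in> J \<Longrightarrow> u \<in> X \<Longrightarrow> v \<in> X
      \<Longrightarrow> dist (\<phi> j u) (\<phi> j v) < \<delta>" for u v j
    unfolding eventually_uniformity_metric by auto
  then have "modulus_on J X \<phi> \<epsilon> \<delta>"
    by (simp add: modulus_on_def less_imp_le)
  with \<open>\<epsilon> > 0\<close> show thesis
    by (rule that)
qed

lemma abs_word_sum_diff_le: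
  assumes "\<And>j. j \<in> J \<Longrightarrow> f j \<in> X \<rightarrow> X" "set C \<subseteq> J" "y \<in> X" "z \<in> word_ball X f y C \<epsilon>"
    and "modulus_on J X \<phi> \<epsilon> \<delta>"
  shows "\<bar>word_sum f \<phi> y C - word_sum f \<phi> z C\<bar> \<le> real (length C) * \<delta>"
proof -
  have "\<bar>\<phi> (C ! k) (word_orbit f C y k) - \<phi> (C ! k) (word_orbit f C z k)\<bar> \<le> \<delta>"
    if "k < length C" for k
  proof -
    have "C ! k \<in> J" "set (rev (take k C)) \<subseteq> J"
      using that assms(2) set_take_subset[of k C] by auto
    moreover have "z \<in> X" "dist (word_orbit f C y k) (word_orbit f C z k) < \<epsilon>"
      using that assms(4) by (auto simp: mem_word_ball_iff)
    moreover from calculation have "word_orbit f C y k \<in> X" "word_orbit f C z k \<in> X"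
      using assms(1,3) by (blast intro: word_map_in)+
    ultimately show ?thesis
      using assms(5) by (simp add: modulus_on_def dist_real_def)
  qed
  then have "(\<Sum>k<length C. \<bar>\<phi> (C ! k) (word_orbit f C y k) - \<phi> (C ! k) (word_orbit f C z k)\<bar>)
    \<le> real (card {..<length C}) * \<delta>"
    by (intro sum_bounded_above) simp
  then show ?thesis
    unfolding word_sum_def sum_subtractf[symmetric] card_lessThan by (rule order_trans[OF sum_abs])
qed

section \<open>Prefixes of sequences\<close>

lemma length_prefix_word [simp]: "length (prefix_word \<omega> n) = n"
  by (simp add: prefix_word_def)

lemma prefix_word_in_words: "\<omega> \<in> seqs m \<Longrightarrow> n > 0 \<Longrightarrow> prefix_word \<omega> n \<in> words m"
  by (auto simp: prefix_word_def words_def seqs_def)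

lemma words_prefixE:
  assumes "C \<in> words m"
  obtains \<omega> where "\<omega> \<in> seqs m" "prefix_word \<omega> (length C) = C"
proof
  let ?\<omega> = "\<lambda>i. if i < length C then C ! i else hd C"
  have "?\<omega> i \<in> set C" for i
    using assms by (simp add: words_def)
  with assms show "?\<omega> \<in> seqs m"
    unfolding words_def seqs_def by blast
  show "prefix_word ?\<omega> (length C) = C"
    by (auto simp: prefix_word_def intro: nth_equalityI)
qed

lemma finite_prefix_words: "finite ((\<lambda>\<omega>. prefix_word \<omega> n) ` seqs m)"
proof (rule finite_subset)
  show "(\<lambda>\<omega>. prefix_word \<omega> n) ` seqs m \<subseteq> {C. set C \<subseteq> {1..m} \<and> length C = n}"
    by (auto simp: prefix_word_def seqs_def)
qed (simp add: finite_lists_length_eq)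

lemma lower_sum_le_word_sum:
  assumes "C \<in> words m"
  shows "lower_sum m f \<phi> (length C) x \<le> word_sum f \<phi> x C"
proof -
  obtain \<omega> where prefix: "\<omega> \<in> seqs m" "prefix_word \<omega> (length C) = C"
    using assms by (rule words_prefixE)
  have "finite (word_sum f \<phi> x ` (\<lambda>\<omega>. prefix_word \<omega> (length C)) ` seqs m)"
    by (intro finite_imageI finite_prefix_words)
  then have "lower_sum m f \<phi> (length C) x \<le> word_sum f \<phi> x (prefix_word \<omega> (length C))"
    unfolding lower_sum_def using prefix(1) by (intro cINF_lower) (simp_all add: image_image)
  then show ?thesis
    by (simp add: prefix(2))
qed

section \<open>Covers\<close>

definition word_weight ::
  "(nat \<Rightarrow> 'a \<Rightarrow> 'a) \<Rightarrow> (nat \<Rightarrow> 'a \<Rightarrow> real) \<Rightarrow> real \<Rightarrow> nat list \<Rightarrow> 'a \<Rightarrow> ennreal" where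
  "word_weight f \<phi> l C y = ennreal (exp (- l * real (length C) + word_sum f \<phi> y C))"

definition word_covers ::
  "nat \<Rightarrow> 'a::metric_space set \<Rightarrow> (nat \<Rightarrow> 'a \<Rightarrow> 'a) \<Rightarrow> 'a set \<Rightarrow> nat \<Rightarrow> real
    \<Rightarrow> (nat list \<times> 'a) set set" where
  "word_covers m X f Y N \<epsilon> =
    {\<Gamma>. countable \<Gamma> \<and> \<Gamma> \<subseteq> words m \<times> X \<and> Y \<subseteq> (\<Union>(C, y)\<in>\<Gamma>. word_ball X f y C \<epsilon>) \<and>
        (\<forall>(C, y)\<in>\<Gamma>. N \<le> length C)}"

definition centred_covers ::
  "'a set \<Rightarrow> (nat \<Rightarrow> 'a \<Rightarrow> real \<Rightarrow> 'b set) \<Rightarrow> 'b set \<Rightarrow> nat \<Rightarrow> real \<Rightarrow> ('a set \<times> ('a \<Rightarrow> nat)) set" where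
  "centred_covers A B Y N \<epsilon> =
    {(\<Gamma>, n). countable \<Gamma> \<and> \<Gamma> \<subseteq> A \<and> (\<forall>y\<in>\<Gamma>. N \<le> n y) \<and> Y \<subseteq> (\<Union>y\<in>\<Gamma>. B (n y) y \<epsilon>)}"

abbreviation trajectory_covers ::
  "'a::metric_space set \<Rightarrow> (nat \<Rightarrow> 'a \<Rightarrow> 'a) \<Rightarrow> (nat \<Rightarrow> nat) \<Rightarrow> 'a set \<Rightarrow> nat \<Rightarrow> real
    \<Rightarrow> ('a set \<times> ('a \<Rightarrow> nat)) set" where
  "trajectory_covers X f \<omega> Y \<equiv> centred_covers Y (\<lambda>n y. word_ball X f y (prefix_word \<omega> n)) Y"

abbreviation exhaustive_covers ::
  "nat \<Rightarrow> 'a::metric_space set \<Rightarrow> (nat \<Rightarrow> 'a \<Rightarrow> 'a) \<Rightarrow> 'a set \<Rightarrow> nat \<Rightarrow> real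
    \<Rightarrow> ('a set \<times> ('a \<Rightarrow> nat)) set" where
  "exhaustive_covers m X f \<equiv> centred_covers X (exhaustive_ball m X f)"

lemma amalgamated_M_eq_INF_word_covers:
  "amalgamated_M m X f \<phi> Y l N \<epsilon> =
    (INF \<Gamma>\<in>word_covers m X f Y N \<epsilon>. \<Sum>\<^sub>\<infinity>(C, y)\<in>\<Gamma>. word_weight f \<phi> l C y)"
  by (simp add: amalgamated_M_def word_covers_def word_weight_def)

lemma trajectory_M_eq_INF_trajectory_covers:
  "trajectory_M X f \<phi> Y \<omega> l N \<epsilon> =
    (INF (\<Gamma>, n)\<in>trajectory_covers X f \<omega> Y N \<epsilon>.
       \<Sum>\<^sub>\<infinity>y\<in>\<Gamma>. word_weight f \<phi> l (prefix_word \<omega> (n y)) y)"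
  by (simp add: trajectory_M_def centred_covers_def word_weight_def)

lemma lower_exhaustive_M_eq_INF_exhaustive_covers:
  "lower_exhaustive_M m X f \<phi> Y l N \<epsilon> =
    (INF (F, n)\<in>exhaustive_covers m X f Y N \<epsilon>.
       \<Sum>\<^sub>\<infinity>x\<in>F. ennreal (exp (lower_sum m f \<phi> (n x) x - l * real (n x))))"
  by (simp add: lower_exhaustive_M_def centred_covers_def)

lemma word_covers_mono:
  assumes "N \<le> N'" "\<epsilon> \<le> \<epsilon>'"
  shows "word_covers m X f Y N' \<epsilon> \<subseteq> word_covers m X f Y N \<epsilon>'"
proof
  fix \<Gamma> assume cover: "\<Gamma> \<in> word_covers m X f Y N' \<epsilon>"
  have "(\<Union>(C, y)\<in>\<Gamma>. word_ball X f y C \<epsilon>) \<subseteq> (\<Union>(C, y)\<in>\<Gamma>. word_ball X f y C \<epsilon>')"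
    unfolding case_prod_beta using assms(2) by (intro UN_mono word_ball_mono order_refl)
  moreover have "\<forall>(C, y)\<in>\<Gamma>. N \<le> length C"
    using cover assms(1) by (fastforce simp: word_covers_def)
  ultimately show "\<Gamma> \<in> word_covers m X f Y N \<epsilon>'"
    using cover unfolding word_covers_def by blast
qed

lemma centred_covers_mono:
  assumes "N \<le> N'" and "\<And>n y. B n y \<epsilon> \<subseteq> B n y \<epsilon>'"
  shows "centred_covers A B Y N' \<epsilon> \<subseteq> centred_covers A B Y N \<epsilon>'"
proof clarify
  fix \<Gamma> n assume cover: "(\<Gamma>, n) \<in> centred_covers A B Y N' \<epsilon>"
  have "(\<Union>y\<in>\<Gamma>. B (n y) y \<epsilon>) \<subseteq> (\<Union>y\<in>\<Gamma>. B (n y) y \<epsilon>')"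
    using assms(2) by (intro UN_mono order_refl)
  moreover have "\<forall>y\<in>\<Gamma>. N \<le> n y"
    using cover assms(1) by (auto simp: centred_covers_def)
  ultimately show "(\<Gamma>, n) \<in> centred_covers A B Y N \<epsilon>'"
    using cover unfolding centred_covers_def by blast
qed

lemma covering_sum_amalgamated_M: "covering_sum (amalgamated_M m X f \<phi> Y)"
  unfolding amalgamated_M_eq_INF_word_covers[abs_def]
  by (intro covering_sum_INF word_covers_mono)

lemma covering_sum_trajectory_M: "covering_sum (trajectory_M X f \<phi> Y \<omega>)"
  unfolding trajectory_M_eq_INF_trajectory_covers[abs_def]
  by (intro covering_sum_INF centred_covers_mono word_ball_mono)

lemma covering_sum_lower_exhaustive_M: "covering_sum (lower_exhaustive_M m X f \<phi> Y)"
  unfolding lower_exhaustive_M_eq_INF_exhaustive_covers[abs_def]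
  by (intro covering_sum_INF centred_covers_mono exhaustive_ball_mono)

section \<open>Amalgamated and trajectory pressure\<close>

lemma trajectory_cover_imp_word_cover:
  assumes "Y \<subseteq> X" "\<omega> \<in> seqs m" "N > 0" "(\<Gamma>, n) \<in> trajectory_covers X f \<omega> Y N \<epsilon>"
  shows "(\<lambda>y. (prefix_word \<omega> (n y), y)) ` \<Gamma> \<in> word_covers m X f Y N \<epsilon>"
proof -
  have cover: "countable \<Gamma>" "\<Gamma> \<subseteq> Y" "\<And>y. y \<in> \<Gamma> \<Longrightarrow> N \<le> n y"
    "Y \<subseteq> (\<Union>y\<in>\<Gamma>. word_ball X f y (prefix_word \<omega> (n y)) \<epsilon>)"
    using assms(4) by (auto simp: centred_covers_def)
  have "prefix_word \<omega> (n y) \<in> words m" if "y \<in> \<Gamma>" for y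
    using assms(2,3) cover(3)[OF that] by (intro prefix_word_in_words) auto
  with cover \<open>Y \<subseteq> X\<close> show ?thesis
    by (auto simp: word_covers_def)
qed

lemma amalgamated_M_le_trajectory_M:
  assumes "Y \<subseteq> X" "\<omega> \<in> seqs m" "N > 0"
  shows "amalgamated_M m X f \<phi> Y l N \<epsilon> \<le> trajectory_M X f \<phi> Y \<omega> l N \<epsilon>"
  unfolding trajectory_M_eq_INF_trajectory_covers
proof (rule INF_greatest, clarify)
  fix \<Gamma> n assume cover: "(\<Gamma>, n) \<in> trajectory_covers X f \<omega> Y N \<epsilon>"
  let ?h = "\<lambda>y. (prefix_word \<omega> (n y), y)"
  have "amalgamated_M m X f \<phi> Y l N \<epsilon> \<le> (\<Sum>\<^sub>\<infinity>(C, y)\<in>?h ` \<Gamma>. word_weight f \<phi> l C y)"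
    unfolding amalgamated_M_eq_INF_word_covers
    using trajectory_cover_imp_word_cover[OF assms cover] by (rule INF_lower)
  also have "\<dots> = (\<Sum>\<^sub>\<infinity>y\<in>\<Gamma>. word_weight f \<phi> l (prefix_word \<omega> (n y)) y)"
    by (subst infsum_reindex) (auto simp: inj_on_def comp_def)
  finally show "amalgamated_M m X f \<phi> Y l N \<epsilon> \<le> \<dots>" .
qed

lemma amalgamated_pressure_le_trajectory_pressure:
  assumes "Y \<subseteq> X" "\<omega> \<in> seqs m"
  shows "amalgamated_pressure m X f \<phi> Y \<le> trajectory_pressure X f \<phi> Y \<omega>"
  unfolding amalgamated_pressure_def trajectory_pressure_def
proof (intro caratheodory_pressure_mono covering_sum_trajectory_M covering_sum_amalgamated_M exI)
  fix l N \<epsilon>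
  \<comment> \<open>Words are nonempty whereas trajectory covers may use \<open>n y = 0\<close>; passing to \<open>Suc N\<close> excludes this.\<close>
  have "amalgamated_M m X f \<phi> Y l N \<epsilon> \<le> amalgamated_M m X f \<phi> Y l (Suc N) \<epsilon>"
    using covering_sum_amalgamated_M by (rule covering_sum_monoD) simp
  also have "\<dots> \<le> trajectory_M X f \<phi> Y \<omega> l (Suc N) \<epsilon>"
    using assms by (rule amalgamated_M_le_trajectory_M) simp
  finally show "amalgamated_M m X f \<phi> Y l N \<epsilon> \<le> trajectory_M X f \<phi> Y \<omega> l (Suc N) \<epsilon>" .
qed

section \<open>Lower exhaustive and amalgamated pressure\<close>

lemma countable_cover_representatives:
  assumes "countable I" "Y \<subseteq> (\<Union>i\<in>I. U i)"
  obtains F c where "F \<subseteq> Y" "countable F" "inj_on c F" "c ` F \<subseteq> I"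
    "\<And>x. x \<in> F \<Longrightarrow> x \<in> U (c x)" "Y \<subseteq> (\<Union>x\<in>F. U (c x))"
proof -
  obtain c where assigned: "\<And>y. y \<in> Y \<Longrightarrow> c y \<in> I \<and> y \<in> U (c y)"
    using assms(2) by (metis UN_E subsetD)
  obtain F where representatives: "F \<subseteq> Y" "inj_on c F" "c ` Y = c ` F"
    using subset_image_inj[of "c ` Y" c Y] by auto
  show thesis
  proof
    show "c ` F \<subseteq> I"
      using assigned representatives(1) by auto
    then show "countable F"
      using assms(1) representatives(2) by (meson countable_image_inj_on countable_subset)
    have "Y \<subseteq> (\<Union>i\<in>c ` Y. U i)"
      using assigned by blast
    then show "Y \<subseteq> (\<Union>x\<in>F. U (c x))"
      by (simp add: representatives(3))
  qed (use assigned representatives in auto)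
qed

lemma word_cover_recentre:
  assumes "Y \<subseteq> X" "\<Gamma> \<in> word_covers m X f Y N \<epsilon>"
  obtains F C y where "(F, \<lambda>x. length (C x)) \<in> exhaustive_covers m X f Y N (2 * \<epsilon>)"
    "inj_on (\<lambda>x. (C x, y x)) F" "\<And>x. x \<in> F \<Longrightarrow> (C x, y x) \<in> \<Gamma>"
    "\<And>x. x \<in> F \<Longrightarrow> x \<in> word_ball X f (y x) (C x) \<epsilon>"
proof -
  have words: "C \<in> words m \<and> N \<le> length C" if "(C, y) \<in> \<Gamma>" for C y
    using assms(2) that by (auto simp: word_covers_def)
  have "countable \<Gamma>" "Y \<subseteq> (\<Union>(C, y)\<in>\<Gamma>. word_ball X f y C \<epsilon>)"
    using assms(2) by (auto simp: word_covers_def)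
  then obtain F c where representatives: "F \<subseteq> Y" "countable F" "inj_on c F" "c ` F \<subseteq> \<Gamma>"
    and mem: "\<And>x. x \<in> F \<Longrightarrow> x \<in> word_ball X f (snd (c x)) (fst (c x)) \<epsilon>"
    and cover: "Y \<subseteq> (\<Union>x\<in>F. word_ball X f (snd (c x)) (fst (c x)) \<epsilon>)"
    unfolding case_prod_beta by (rule countable_cover_representatives) blast
  have chosen: "(fst (c x), snd (c x)) \<in> \<Gamma>" if "x \<in> F" for x
    using representatives(4) that by auto
  have "word_ball X f (snd (c x)) (fst (c x)) \<epsilon>
      \<subseteq> exhaustive_ball m X f (length (fst (c x))) x (2 * \<epsilon>)" if "x \<in> F" for x
  proof -
    have "word_ball X f (snd (c x)) (fst (c x)) \<epsilon> \<subseteq> word_ball X f x (fst (c x)) (2 * \<epsilon>)"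
      unfolding mult_2 using mem[OF that] by (rule word_ball_triangle)
    also have "\<dots> \<subseteq> exhaustive_ball m X f (length (fst (c x))) x (2 * \<epsilon>)"
      using words[OF chosen[OF that]] by (intro word_ball_subset_exhaustive_ball) simp
    finally show ?thesis .
  qed
  then have "(\<Union>x\<in>F. word_ball X f (snd (c x)) (fst (c x)) \<epsilon>)
      \<subseteq> (\<Union>x\<in>F. exhaustive_ball m X f (length (fst (c x))) x (2 * \<epsilon>))"
    by (intro UN_mono order_refl)
  with cover have "Y \<subseteq> (\<Union>x\<in>F. exhaustive_ball m X f (length (fst (c x))) x (2 * \<epsilon>))"
    by (rule order_trans)
  then have "(F, \<lambda>x. length (fst (c x))) \<in> exhaustive_covers m X f Y N (2 * \<epsilon>)"
    using representatives(1,2) \<open>Y \<subseteq> X\<close> words[OF chosen] by (auto simp: centred_covers_def)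
  then show thesis
    using representatives(3) chosen mem by (intro that[of F "\<lambda>x. fst (c x)" "\<lambda>x. snd (c x)"]) auto
qed

lemma lower_exhaustive_weight_le_word_weight:
  assumes "\<And>j. j \<in> {1..m} \<Longrightarrow> f j \<in> X \<rightarrow> X" "C \<in> words m" "y \<in> X" "x \<in> word_ball X f y C \<epsilon>"
    and "modulus_on {1..m} X \<phi> \<epsilon> \<delta>"
  shows "ennreal (exp (lower_sum m f \<phi> (length C) x - (l + \<delta>) * real (length C)))
    \<le> word_weight f \<phi> l C y"
proof -
  have "lower_sum m f \<phi> (length C) x \<le> word_sum f \<phi> x C"
    using \<open>C \<in> words m\<close> by (rule lower_sum_le_word_sum)
  moreover have "\<bar>word_sum f \<phi> y C - word_sum f \<phi> x C\<bar> \<le> real (length C) * \<delta>"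
    using assms by (intro abs_word_sum_diff_le[of "{1..m}"]) (auto simp: words_def)
  ultimately show ?thesis
    by (simp add: word_weight_def ennreal_leI algebra_simps)
qed

lemma infsum_le_infsum_inj_on:
  fixes g :: "'i \<Rightarrow> 'b::{complete_linorder, ordered_comm_monoid_add, linorder_topology}"
  assumes "inj_on h A" "h ` A \<subseteq> B"
    and "\<And>x. x \<in> A \<Longrightarrow> 0 \<le> g x" "\<And>y. y \<in> B \<Longrightarrow> 0 \<le> k y" "\<And>x. x \<in> A \<Longrightarrow> g x \<le> k (h x)"
  shows "infsum g A \<le> infsum k B"
proof -
  have "infsum g A \<le> infsum (k \<circ> h) A"
    using assms by (intro infsum_mono nonneg_summable_on_complete) auto
  also have "\<dots> = infsum k (h ` A)"
    using assms(1) by (rule infsum_reindex[symmetric])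
  also have "\<dots> \<le> infsum k B"
    using assms by (intro infsum_mono_neutral nonneg_summable_on_complete) auto
  finally show ?thesis .
qed

lemma lower_exhaustive_M_le_amalgamated_M:
  assumes "\<And>j. j \<in> {1..m} \<Longrightarrow> f j \<in> X \<rightarrow> X" "Y \<subseteq> X" "modulus_on {1..m} X \<phi> \<epsilon> \<delta>"
  shows "lower_exhaustive_M m X f \<phi> Y (l + \<delta>) N (2 * \<epsilon>) \<le> amalgamated_M m X f \<phi> Y l N \<epsilon>"
  unfolding amalgamated_M_eq_INF_word_covers
proof (rule INF_greatest)
  fix \<Gamma> assume cover: "\<Gamma> \<in> word_covers m X f Y N \<epsilon>"
  with \<open>Y \<subseteq> X\<close> obtain F C y
    where recentred: "(F, \<lambda>x. length (C x)) \<in> exhaustive_covers m X f Y N (2 * \<epsilon>)"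
      and inj: "inj_on (\<lambda>x. (C x, y x)) F"
      and mem: "\<And>x. x \<in> F \<Longrightarrow> (C x, y x) \<in> \<Gamma>" "\<And>x. x \<in> F \<Longrightarrow> x \<in> word_ball X f (y x) (C x) \<epsilon>"
    by (rule word_cover_recentre) blast
  have "lower_exhaustive_M m X f \<phi> Y (l + \<delta>) N (2 * \<epsilon>)
    \<le> (\<Sum>\<^sub>\<infinity>x\<in>F. ennreal (exp (lower_sum m f \<phi> (length (C x)) x - (l + \<delta>) * real (length (C x)))))"
    unfolding lower_exhaustive_M_eq_INF_exhaustive_covers by (rule INF_lower2[OF recentred]) simp
  also have "\<dots> \<le> (\<Sum>\<^sub>\<infinity>(C, y)\<in>\<Gamma>. word_weight f \<phi> l C y)"
  proof (rule infsum_le_infsum_inj_on[OF inj])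
    fix x assume "x \<in> F"
    moreover from this have "C x \<in> words m" "y x \<in> X"
      using cover mem(1) by (auto simp: word_covers_def)
    ultimately show "ennreal (exp (lower_sum m f \<phi> (length (C x)) x - (l + \<delta>) * real (length (C x))))
      \<le> (case (C x, y x) of (C, y) \<Rightarrow> word_weight f \<phi> l C y)"
      using assms(1,3) mem(2) unfolding prod.case
      by (intro lower_exhaustive_weight_le_word_weight) auto
  qed (use mem in auto)
  finally show "lower_exhaustive_M m X f \<phi> Y (l + \<delta>) N (2 * \<epsilon>) \<le> \<dots>" .
qed

lemma lower_exhaustive_pressure_le_amalgamated_pressure:
  assumes "compact X" "\<And>j. j \<in> {1..m} \<Longrightarrow> f j \<in> X \<rightarrow> X"
    and "\<And>j. j \<in> {1..m} \<Longrightarrow> continuous_on X (\<phi> j)" "Y \<subseteq> X"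
  shows "lower_exhaustive_pressure m X f \<phi> Y \<le> amalgamated_pressure m X f \<phi> Y"
  unfolding amalgamated_pressure_def lower_exhaustive_pressure_def
proof (rule caratheodory_pressure_le_shift[OF covering_sum_amalgamated_M covering_sum_lower_exhaustive_M])
  fix \<delta> \<epsilon>' :: real assume "\<delta> > 0" "\<epsilon>' > 0"
  obtain r where "r > 0" "modulus_on {1..m} X \<phi> r \<delta>"
    using \<open>compact X\<close> finite_atLeastAtMost assms(3) \<open>\<delta> > 0\<close>
    by (rule compact_finite_family_modulus_on)
  define \<epsilon> where "\<epsilon> = min r (\<epsilon>' / 2)"
  have "\<epsilon> > 0" "2 * \<epsilon> \<le> \<epsilon>'" and modulus: "modulus_on {1..m} X \<phi> \<epsilon> \<delta>"
    using \<open>r > 0\<close> \<open>\<epsilon>' > 0\<close> modulus_on_antimono[OF \<open>modulus_on _ X \<phi> r \<delta>\<close>, of \<epsilon>]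
    by (auto simp: \<epsilon>_def)
  have "lower_exhaustive_M m X f \<phi> Y (l + \<delta>) N \<epsilon>' \<le> amalgamated_M m X f \<phi> Y l N \<epsilon>" for l N
  proof -
    have "lower_exhaustive_M m X f \<phi> Y (l + \<delta>) N \<epsilon>'
      \<le> lower_exhaustive_M m X f \<phi> Y (l + \<delta>) N (2 * \<epsilon>)"
      using covering_sum_lower_exhaustive_M \<open>2 * \<epsilon> \<le> \<epsilon>'\<close> by (rule covering_sum_antimonoD)
    also have "\<dots> \<le> amalgamated_M m X f \<phi> Y l N \<epsilon>"
      using assms(2,4) modulus by (rule lower_exhaustive_M_le_amalgamated_M)
    finally show ?thesis .
  qed
  with \<open>\<epsilon> > 0\<close> show "\<exists>\<epsilon>>0. \<forall>l N.
      lower_exhaustive_M m X f \<phi> Y (l + \<delta>) N \<epsilon>' \<le> amalgamated_M m X f \<phi> Y l N \<epsilon>"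
    by blast
qed

theorem theorem3p14:
  fixes X Y :: "'a::metric_space set"
    and m :: nat
    and f :: "nat \<Rightarrow> 'a \<Rightarrow> 'a"
    and \<phi> :: "nat \<Rightarrow> 'a \<Rightarrow> real"
    and \<omega> :: "nat \<Rightarrow> nat"
  assumes "compact X"
    and "\<And>j. j \<in> {1..m} \<Longrightarrow> f j \<in> X \<rightarrow> X"
    and "\<And>j. j \<in> {1..m} \<Longrightarrow> continuous_on X (f j)"
    and "\<And>j. j \<in> {1..m} \<Longrightarrow> continuous_on X (\<phi> j)"
    and "Y \<subseteq> X"
    and "\<omega> \<in> seqs m"
  shows "(lower_exhaustive_pressure m X f \<phi> Y \<le> amalgamated_pressure m X f \<phi> Y \<and>
          amalgamated_pressure m X f \<phi> Y \<le> trajectory_pressure X f \<phi> Y \<omega>) \<and>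
         (\<forall>j\<in>{1..m}.
            lower_exhaustive_pressure m X f \<phi> Y \<le> amalgamated_pressure m X f \<phi> Y \<and>
            amalgamated_pressure m X f \<phi> Y \<le> topological_pressure X (f j) (\<phi> j) Y)"
proof -
  have lower: "lower_exhaustive_pressure m X f \<phi> Y \<le> amalgamated_pressure m X f \<phi> Y"
    using assms(1,2,4,5) by (rule lower_exhaustive_pressure_le_amalgamated_pressure)
  have upper: "amalgamated_pressure m X f \<phi> Y \<le> trajectory_pressure X f \<phi> Y \<theta>"
    if "\<theta> \<in> seqs m" for \<theta>
    using assms(5) that by (rule amalgamated_pressure_le_trajectory_pressure)
  have "amalgamated_pressure m X f \<phi> Y \<le> topological_pressure X (f j) (\<phi> j) Y"
    if "j \<in> {1..m}" for j
    using upper[of "\<lambda>_. j"] that by (simp add: seqs_def trajectory_pressure_const)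
  with lower upper[OF assms(6)] show ?thesis
    by blast
qed

end
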